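(* Assuming the strong exponential time hypothesis (SETH), for no $\epsilon>0$ is there an algorithm that solves \textsc{Colorful Graph Motif} in $(2-\epsilon)^{\ell}\cdot n^{\mathcal{O}(1)}$ time, where $n=|V|$ and $\ell=|V|-|M|$.
   Context: \textsc{Colorful Graph Motif} (CGM): the input is a set $M$ of colors (built from a color set $C$), an undirected graph $G=(V,E)$, and a coloring $\chi:V\to C$; the question is whether there is a set $S\subseteq V$ such that $G[S]$ is connected and there is a one-to-one mapping $f:S\to M$ with $f(v)=\chi(v)$ for all $v\in S$ (i.e. $S$ contains exactly one vertex of each color of $M$ and no other vertices). The parameter is $\ell:=|V|-|M|$. SETH: for every $\epsilon>0$, CNF-SAT cannot be solved in $(2-\epsilon)^{r}\cdot|\Phi|^{\mathcal{O}(1)}$ time, where $\Phi$ is the input formula and $r$ its number of variables. *)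

theory Defs
  imports
    Complex_Main
    "HOL-Computational_Algebra.Polynomial"
    "Graph_Theory.Graph_Theory"
begin

section \<open>Model of computation\<close>

text \<open>
  Algorithms are programs of the WHILE language over binary trees (N. D. Jones,
  \<^emph>\<open>Computability and Complexity from a Programming Perspective\<close>): variables hold trees, the
  only data operations are the constant \<open>nil\<close>, pairing and the two projections, and the only test
  is the test for \<open>nil\<close>. Each operation costs one time unit. Since a tree is handled through a
  pointer to its root, a step is a constant number of pointer operations; conversely a
  logarithmic-cost random access machine is simulated with an overhead factor polylogarithmic in
  the running time. Such a
  factor is absorbed by the polynomial in a bound of the form \<open>(2 - \<epsilon>)\<^sup>\<ell> \<cdot> poly(n)\<close>, so these
  bounds are achievable in one of the two models iff they are in the other.
\<close>

datatype data = Nl | Node data data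

fun fst_data :: "data \<Rightarrow> data" where
  "fst_data Nl = Nl"
| "fst_data (Node a b) = a"

fun snd_data :: "data \<Rightarrow> data" where
  "snd_data Nl = Nl"
| "snd_data (Node a b) = b"

datatype expr = Var nat | Nil_E | Pair_E expr expr | Fst_E expr | Snd_E expr

type_synonym store = "nat \<Rightarrow> data"

fun eval_expr :: "expr \<Rightarrow> store \<Rightarrow> data" where
  "eval_expr (Var x) s = s x"
| "eval_expr Nil_E s = Nl"
| "eval_expr (Pair_E e f) s = Node (eval_expr e s) (eval_expr f s)"
| "eval_expr (Fst_E e) s = fst_data (eval_expr e s)"
| "eval_expr (Snd_E e) s = snd_data (eval_expr e s)"

fun expr_cost :: "expr \<Rightarrow> nat" where
  "expr_cost (Var x) = 1"
| "expr_cost Nil_E = 1"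
| "expr_cost (Pair_E e f) = expr_cost e + expr_cost f + 1"
| "expr_cost (Fst_E e) = expr_cost e + 1"
| "expr_cost (Snd_E e) = expr_cost e + 1"

datatype prog = Asgn nat expr | Seq prog prog | Cond expr prog prog | Loop expr prog

text \<open>\<open>exec p s t s'\<close>: program \<open>p\<close>, started in store \<open>s\<close>, halts after \<open>t\<close> steps in store \<open>s'\<close>.\<close>

inductive exec :: "prog \<Rightarrow> store \<Rightarrow> nat \<Rightarrow> store \<Rightarrow> bool" where
  Asgn: "exec (Asgn x e) s (expr_cost e + 1) (s(x := eval_expr e s))"
| Seq: "exec p s t s' \<Longrightarrow> exec q s' u s'' \<Longrightarrow> exec (Seq p q) s (t + u) s''"
| CondTrue: "eval_expr e s \<noteq> Nl \<Longrightarrow> exec p s t s' \<Longrightarrow>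
    exec (Cond e p q) s (expr_cost e + 1 + t) s'"
| CondFalse: "eval_expr e s = Nl \<Longrightarrow> exec q s t s' \<Longrightarrow>
    exec (Cond e p q) s (expr_cost e + 1 + t) s'"
| LoopFalse: "eval_expr e s = Nl \<Longrightarrow> exec (Loop e p) s (expr_cost e + 1) s"
| LoopTrue: "eval_expr e s \<noteq> Nl \<Longrightarrow> exec p s t s' \<Longrightarrow> exec (Loop e p) s' u s'' \<Longrightarrow>
    exec (Loop e p) s (expr_cost e + 1 + t + u) s''"

inductive_cases AsgnE: "exec (Asgn x e) s t s'"
inductive_cases SeqE: "exec (Seq p q) s t s'"
inductive_cases CondE: "exec (Cond e p q) s t s'"
inductive_cases LoopE: "exec (Loop e p) s t s'"

lemma exec_deterministic:
  "exec p s t s' \<Longrightarrow> exec p s u s'' \<Longrightarrow> t = u \<and> s' = s''"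
proof (induction arbitrary: u s'' rule: exec.induct)
  case (Asgn x e s)
  from Asgn.prems show ?case by (rule AsgnE) simp
next
  case (Seq p s t\<^sub>1 s\<^sub>1 q t\<^sub>2 s\<^sub>2)
  from Seq.prems obtain u\<^sub>1 r u\<^sub>2 where "u = u\<^sub>1 + u\<^sub>2" "exec p s u\<^sub>1 r" "exec q r u\<^sub>2 s''"
    by (rule SeqE)
  with Seq.IH(1)[of u\<^sub>1 r] Seq.IH(2)[of u\<^sub>2 s''] show ?case by simp
next
  case (CondTrue e s p t s' q)
  from CondTrue.prems CondTrue.hyps(1) obtain v where "u = expr_cost e + 1 + v" "exec p s v s''"
    by (elim CondE) simp_all
  with CondTrue.IH[of v s''] show ?case by simp
next
  case (CondFalse e s q t s' p)
  from CondFalse.prems CondFalse.hyps(1) obtain v where "u = expr_cost e + 1 + v" "exec q s v s''"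
    by (elim CondE) simp_all
  with CondFalse.IH[of v s''] show ?case by simp
next
  case (LoopFalse e s p)
  from LoopFalse.prems show ?case by (rule LoopE) (use LoopFalse.hyps in simp_all)
next
  case (LoopTrue e s p t\<^sub>1 s\<^sub>1 t\<^sub>2 s\<^sub>2)
  from LoopTrue.prems obtain u\<^sub>1 r u\<^sub>2 where
    "u = expr_cost e + 1 + u\<^sub>1 + u\<^sub>2" "exec p s u\<^sub>1 r" "exec (Loop e p) r u\<^sub>2 s''"
    by (rule LoopE) (use LoopTrue.hyps(1) in simp_all)
  with LoopTrue.IH(1)[of u\<^sub>1 r] LoopTrue.IH(2)[of u\<^sub>2 s''] show ?case by simp
qed

text \<open>The input is passed, and the answer returned, in variable 0.\<close>

definition init_store :: "data \<Rightarrow> store" where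
  "init_store d = (\<lambda>_. Nl)(0 := d)"

text \<open>
  The decision problem with instance set \<open>X\<close> and yes-instances \<open>{x \<in> X. Q x}\<close> is solved by a
  program that, on every instance \<open>x\<close> encoded as \<open>enc x\<close>, halts with the correct answer after at
  most \<open>T x\<close> steps.
\<close>

definition solvable_within ::
    "'i set \<Rightarrow> ('i \<Rightarrow> bool) \<Rightarrow> ('i \<Rightarrow> data) \<Rightarrow> ('i \<Rightarrow> real) \<Rightarrow> bool" where
  "solvable_within X Q enc T \<longleftrightarrow>
     (\<exists>p. \<forall>x\<in>X. \<exists>t s. exec p (init_store (enc x)) t s \<and> (s 0 \<noteq> Nl \<longleftrightarrow> Q x) \<and> real t \<le> T x)"

fun enc_bool :: "bool \<Rightarrow> data" where
  "enc_bool False = Nl"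
| "enc_bool True = Node Nl Nl"

fun enc_nat :: "nat \<Rightarrow> data" where
  "enc_nat 0 = Nl"
| "enc_nat (Suc n) = Node Nl (enc_nat n)"

fun enc_list :: "('a \<Rightarrow> data) \<Rightarrow> 'a list \<Rightarrow> data" where
  "enc_list f [] = Nl"
| "enc_list f (x # xs) = Node (f x) (enc_list f xs)"


section \<open>CNF-SAT and the strong exponential time hypothesis\<close>

text \<open>The literal \<open>(x, True)\<close> is the variable \<open>x\<close>, the literal \<open>(x, False)\<close> its negation.\<close>

type_synonym literal = "nat \<times> bool"
type_synonym cnf = "literal list list"

definition cnf_vars :: "cnf \<Rightarrow> nat set" where
  "cnf_vars \<Phi> = (\<Union>C\<in>set \<Phi>. fst ` set C)"

definition num_vars :: "cnf \<Rightarrow> nat" where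
  "num_vars \<Phi> = card (cnf_vars \<Phi>)"

definition cnf_size :: "cnf \<Rightarrow> nat" where
  "cnf_size \<Phi> = (\<Sum>C\<leftarrow>\<Phi>. length C + 1)"

definition cnf_satisfiable :: "cnf \<Rightarrow> bool" where
  "cnf_satisfiable \<Phi> \<longleftrightarrow>
     (\<exists>\<alpha> :: nat \<Rightarrow> bool. \<forall>C\<in>set \<Phi>. \<exists>(x, b)\<in>set C. \<alpha> x = b)"

text \<open>
  The variables of a formula are numbered consecutively. Hence numbers may be written in unary: the
  encoding has size polynomial in \<^const>\<open>cnf_size\<close>.
\<close>

definition cnf_instances :: "cnf set" where
  "cnf_instances = {\<Phi>. cnf_vars \<Phi> = {..<num_vars \<Phi>}}"

definition enc_literal :: "literal \<Rightarrow> data" where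
  "enc_literal l = Node (enc_nat (fst l)) (enc_bool (snd l))"

definition enc_cnf :: "cnf \<Rightarrow> data" where
  "enc_cnf \<Phi> = Node (enc_nat (num_vars \<Phi>)) (enc_list (enc_list enc_literal) \<Phi>)"

text \<open>
  A factor \<open>n\<close> to the power \<open>O(1)\<close> in a running time is a polynomial in \<open>n\<close>; coefficients are
  natural numbers, so that the polynomial is nonnegative.
\<close>

definition SETH :: bool where
  "SETH \<longleftrightarrow> (\<forall>\<epsilon>::real. \<epsilon> > 0 \<longrightarrow> \<not> (\<exists>q :: nat poly.
     solvable_within cnf_instances cnf_satisfiable enc_cnf
       (\<lambda>\<Phi>. (2 - \<epsilon>) ^ num_vars \<Phi> * real (poly q (cnf_size \<Phi>)))))"


section \<open>Colorful Graph Motif\<close>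

record cgm =
  cgm_motif :: "nat set"
  cgm_graph :: "nat pair_pre_digraph"
  cgm_coloring :: "nat \<Rightarrow> nat"

definition cgm_verts :: "cgm \<Rightarrow> nat set" where
  "cgm_verts I = pverts (cgm_graph I)"

definition cgm_colors :: "cgm \<Rightarrow> nat set" where
  "cgm_colors I = cgm_motif I \<union> cgm_coloring I ` cgm_verts I"

text \<open>
  Vertices, and the colors that occur in the motif or on a vertex, are numbered consecutively. The
  condition \<open>|M| \<le> |V|\<close> says that the parameter \<open>\<ell> = |V| - |M|\<close> is a natural number; it also bounds
  the number of colors by \<open>2 |V|\<close>, so that the encoding below has size polynomial in \<open>|V|\<close>.
\<close>

definition cgm_instances :: "cgm set" where
  "cgm_instances = {I. pair_graph (cgm_graph I)
     \<and> cgm_verts I = {..<card (cgm_verts I)}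
     \<and> cgm_colors I = {..<card (cgm_colors I)}
     \<and> card (cgm_motif I) \<le> card (cgm_verts I)}"

definition cgm_param :: "cgm \<Rightarrow> nat" where
  "cgm_param I = card (cgm_verts I) - card (cgm_motif I)"

text \<open>
  A connected graph has at least one vertex by definition of \<^const>\<open>Digraph_Component.connected\<close>, so an instance
  with empty motif is a no-instance.
\<close>

definition cgm_solvable :: "cgm \<Rightarrow> bool" where
  "cgm_solvable I \<longleftrightarrow>
     (\<exists>S \<subseteq> cgm_verts I.
        Digraph_Component.connected (with_proj (cgm_graph I) \<restriction> S)
        \<and> (\<exists>f. bij_betw f S (cgm_motif I) \<and> (\<forall>v\<in>S. f v = cgm_coloring I v)))"

text \<open>
  Adjacency matrix, list of vertex colors, and characteristic vector of the motif.
\<close>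

definition enc_cgm :: "cgm \<Rightarrow> data" where
  "enc_cgm I =
     (let n = card (cgm_verts I); k = card (cgm_colors I) in
      Node (enc_list (\<lambda>u. enc_list (\<lambda>v. enc_bool ((u, v) \<in> parcs (cgm_graph I))) [0..<n]) [0..<n])
        (Node (enc_list (\<lambda>v. enc_nat (cgm_coloring I v)) [0..<n])
          (enc_list (\<lambda>c. enc_bool (c \<in> cgm_motif I)) [0..<k])))"

end

theory Submission
  imports Defs
begin

text \<open>
  A formula with \<open>r\<close> variables and \<open>m\<close> clauses becomes a graph with a root, two literal vertices of
  the same color per variable, and one clause vertex per clause; root and clause vertices have
  private colors. The root is adjacent to all literals, and a clause to the literals it contains.
  With all \<open>r + m + 1\<close> colors in the motif, a set \<open>S\<close> of the required colors contains the root, all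
  clauses and one literal of each variable, that is, an assignment; it is connected iff every clause
  is adjacent to a literal of the assignment. Since \<open>|V| = 2 r + m + 1\<close>, the parameter is \<open>\<ell> = r\<close>,
  so the base of the exponential is preserved.

  That WHILE programs compute the reduction in polynomial time follows from closure properties of
  the functions on trees with polynomially bounded time and output size, the main one being closure
  under folds with polynomially bounded accumulators.
\<close>

section \<open>Polynomial-time functions on trees\<close>

text \<open>With natural coefficients no monomial decreases. This lets a size bound be substituted
  into a time bound.\<close>

lemma poly_nat_mono: "m \<le> n \<Longrightarrow> poly q m \<le> poly q n" for q :: "nat poly"
  by (induction q) (auto intro!: add_mono mult_mono)

text \<open>
  The program reads its argument from and writes its result to variable 0. It must work for every
  initial content of its scratch variables, all of which lie below \<open>k\<close>.
\<close>

definition computes :: "prog \<Rightarrow> nat \<Rightarrow> nat poly \<Rightarrow> (data \<Rightarrow> data) \<Rightarrow> bool" where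
  "computes p k q f \<longleftrightarrow> 0 < k \<and> (\<forall>s. \<exists>t s'. exec p s t s' \<and> s' 0 = f (s 0) \<and> (\<forall>i\<ge>k. s' i = s i)
     \<and> t \<le> poly q (size (s 0)) \<and> size (f (s 0)) \<le> poly q (size (s 0)))"

text \<open>
  The bound on the size of the result does not follow from the bound on the time: repeated pairing
  of a tree with itself doubles its size in constant time.
\<close>

definition fptime :: "(data \<Rightarrow> data) \<Rightarrow> bool" where
  "fptime f \<longleftrightarrow> (\<exists>p k q. computes p k q f)"

lemma fptimeI:
  assumes "0 < k"
    and "\<And>s. \<exists>t s'. exec p s t s' \<and> s' 0 = f (s 0) \<and> (\<forall>i\<ge>k. s' i = s i) \<and> t \<le> poly q (size (s 0))"
    and "\<And>d. size (f d) \<le> poly r (size d)"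
  shows "fptime f"
proof -
  have "computes p k (q + r) f"
    unfolding computes_def
  proof (intro conjI allI)
    fix s :: store
    obtain t s' where "exec p s t s'" "s' 0 = f (s 0)" "\<forall>i\<ge>k. s' i = s i" "t \<le> poly q (size (s 0))"
      using assms(2)[of s] by blast
    then show "\<exists>t s'. exec p s t s' \<and> s' 0 = f (s 0) \<and> (\<forall>i\<ge>k. s' i = s i)
     \<and> t \<le> poly (q + r) (size (s 0)) \<and> size (f (s 0)) \<le> poly (q + r) (size (s 0))"
      using assms(3)[of "s 0"] by (intro exI[of _ t] exI[of _ s']) simp
  qed (fact assms(1))
  then show ?thesis unfolding fptime_def by blast
qed

lemma computesD:
  assumes "computes p k q f"
  shows "\<exists>t s'. exec p s t s' \<and> s' 0 = f (s 0) \<and> (\<forall>i\<ge>k. s' i = s i) \<and> t \<le> poly q (size (s 0))"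
  using assms unfolding computes_def by meson

lemma computes_size: "computes p k q f \<Longrightarrow> size (f d) \<le> poly q (size d)"
  \<comment> \<open>Any tree \<open>d\<close> is \<open>s 0\<close> for a suitable store, so the
    bound on stores is one on trees.\<close>
  unfolding computes_def by (metis fun_upd_same)

lemma fptime_size:
  assumes "fptime f"
  obtains q :: "nat poly" where "\<And>d. size (f d) \<le> poly q (size d)"
  using assms computes_size unfolding fptime_def by metis

lemma fptime_expr:
  assumes "\<And>s. eval_expr e s = f (s 0)" and "\<And>d. size (f d) \<le> poly r (size d)"
  shows "fptime f"
proof (rule fptimeI[where k = 1 and p = "Asgn 0 e" and q = "[:expr_cost e + 1:]" and r = r])
  fix s :: store
  show "\<exists>t s'. exec (Asgn 0 e) s t s' \<and> s' 0 = f (s 0) \<and> (\<forall>i\<ge>1. s' i = s i)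
      \<and> t \<le> poly [:expr_cost e + 1:] (size (s 0))"
    using exec.Asgn[of 0 e s] assms(1)[of s]
    by (intro exI[of _ "expr_cost e + 1"] exI[of _ "s(0 := eval_expr e s)"]) auto
qed (use assms(2) in auto)

lemma size_fst_data_le: "size (fst_data d) \<le> size d"
  by (cases d) auto

lemma size_snd_data_le: "size (snd_data d) \<le> size d"
  by (cases d) auto

lemma fptime_id: "fptime (\<lambda>d. d)"
  by (rule fptime_expr[where e = "Var 0" and r = "[:0, 1:]"]) auto

lemma fptime_Nl: "fptime (\<lambda>_. Nl)"
  by (rule fptime_expr[where e = Nil_E and r = 0]) auto

lemma fptime_fst_data: "fptime fst_data"
  by (rule fptime_expr[where e = "Fst_E (Var 0)" and r = "[:0, 1:]"]) (auto simp: size_fst_data_le)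

lemma fptime_snd_data: "fptime snd_data"
  by (rule fptime_expr[where e = "Snd_E (Var 0)" and r = "[:0, 1:]"]) (auto simp: size_snd_data_le)

text \<open>The second program runs on a tree of size at most \<open>poly q\<close>, so its time is
  bounded by \<open>pcompose q' q\<close>. This is what the size bound in \<open>computes\<close> is
  for.\<close>

lemma fptime_comp:
  assumes "fptime f" "fptime g"
  shows "fptime (\<lambda>d. g (f d))"
proof -
  obtain p k q where p: "computes p k q f" using assms(1) unfolding fptime_def by blast
  obtain p' k' q' where p': "computes p' k' q' g" using assms(2) unfolding fptime_def by blast
  show ?thesis
  proof (rule fptimeI[where k = "max k k'" and p = "Seq p p'" and q = "q + pcompose q' q"
        and r = "pcompose q' q"])
    show "0 < max k k'" using p unfolding computes_def by auto
    show "size (g (f d)) \<le> poly (pcompose q' q) (size d)" for d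
      using computes_size[OF p', of "f d"] poly_nat_mono[OF computes_size[OF p], of q' d]
      by (simp add: poly_pcompose)
    fix s :: store
    obtain t s' where 1: "exec p s t s'" "s' 0 = f (s 0)" "\<forall>i\<ge>k. s' i = s i"
      "t \<le> poly q (size (s 0))" using computesD[OF p, of s] by blast
    obtain t' s'' where 2: "exec p' s' t' s''" "s'' 0 = g (s' 0)" "\<forall>i\<ge>k'. s'' i = s' i"
      "t' \<le> poly q' (size (s' 0))" using computesD[OF p', of s'] by blast
    have "t' \<le> poly q' (poly q (size (s 0)))"
      using 1(2) 2(4) poly_nat_mono[OF computes_size[OF p], of q' "s 0"] by simp
    then show "\<exists>t s'. exec (Seq p p') s t s' \<and> s' 0 = g (f (s 0)) \<and> (\<forall>i\<ge>max k k'. s' i = s i)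
        \<and> t \<le> poly (q + pcompose q' q) (size (s 0))"
      using exec.Seq[OF 1(1) 2(1)] 1 2
      by (intro exI[of _ "t + t'"] exI[of _ s'']) (auto simp: poly_pcompose)
  qed
qed

lemma fptime_fst: "fptime f \<Longrightarrow> fptime (\<lambda>d. fst_data (f d))"
  by (rule fptime_comp[OF _ fptime_fst_data])

lemma fptime_snd: "fptime f \<Longrightarrow> fptime (\<lambda>d. snd_data (f d))"
  by (rule fptime_comp[OF _ fptime_snd_data])

lemma fptime_Node:
  assumes "fptime f" "fptime g"
  shows "fptime (\<lambda>d. Node (f d) (g d))"
proof -
  obtain p k q where p: "computes p k q f" using assms(1) unfolding fptime_def by blast
  obtain p' k' q' where p': "computes p' k' q' g" using assms(2) unfolding fptime_def by blast
  \<comment> \<open>\<open>K\<close> and \<open>Suc K\<close> lie above the scratch variables of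
    both programs, so the saved input and the first result survive both runs.\<close>
  define K where "K = max k k'"
  have K: "k \<le> K" "k' \<le> K" "0 < K" using p by (auto simp: K_def computes_def)
  let ?P = "Seq (Asgn K (Var 0)) (Seq p (Seq (Asgn (Suc K) (Var 0)) (Seq (Asgn 0 (Var K))
    (Seq p' (Asgn 0 (Pair_E (Var (Suc K)) (Var 0)))))))"
  show ?thesis
  proof (rule fptimeI[where k = "K + 2" and p = ?P and q = "q + q' + [:10:]" and r = "q + q' + 1"])
    show "size (Node (f d) (g d)) \<le> poly (q + q' + 1) (size d)" for d
      using computes_size[OF p, of d] computes_size[OF p', of d] by simp
    fix s :: store
    let ?s1 = "s(K := s 0)"
    obtain t s2 where 1: "exec p ?s1 t s2" "s2 0 = f (?s1 0)" "\<forall>i\<ge>k. s2 i = ?s1 i"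
      "t \<le> poly q (size (?s1 0))" using computesD[OF p, of ?s1] by blast
    let ?s3 = "s2(Suc K := s2 0, 0 := s2 K)"
    obtain t' s4 where 2: "exec p' ?s3 t' s4" "s4 0 = g (?s3 0)" "\<forall>i\<ge>k'. s4 i = ?s3 i"
      "t' \<le> poly q' (size (?s3 0))" using computesD[OF p', of ?s3] by blast
    let ?s5 = "s4(0 := Node (s4 (Suc K)) (s4 0))"
    have "exec ?P s (2 + (t + (2 + (2 + (t' + 4))))) ?s5"
      using exec.Asgn[of K "Var 0" s] exec.Asgn[of "Suc K" "Var 0" s2]
        exec.Asgn[of 0 "Var K" "s2(Suc K := s2 0)"]
        exec.Asgn[of 0 "Pair_E (Var (Suc K)) (Var 0)" s4] 1(1) 2(1)
      by (intro exec.Seq) (simp_all add: numeral_eq_Suc)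
    then show "\<exists>t s'. exec ?P s t s' \<and> s' 0 = Node (f (s 0)) (g (s 0)) \<and> (\<forall>i\<ge>K + 2. s' i = s i)
        \<and> t \<le> poly (q + q' + [:10:]) (size (s 0))"
      using 1 2 K by (intro exI conjI) (assumption, auto)
  qed (use K in auto)
qed

lemma fptime_if:
  assumes "fptime c" "fptime f" "fptime g"
  shows "fptime (\<lambda>d. if c d \<noteq> Nl then f d else g d)"
proof -
  obtain p k q where p: "computes p k q c" using assms(1) unfolding fptime_def by blast
  obtain p' k' q' where p': "computes p' k' q' f" using assms(2) unfolding fptime_def by blast
  obtain p'' k'' q'' where p'': "computes p'' k'' q'' g" using assms(3) unfolding fptime_def by blast
  define K where "K = max k (max k' k'')"
  have K: "k \<le> K" "k' \<le> K" "k'' \<le> K" "0 < K" using p by (auto simp: K_def computes_def)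
  let ?C = "Cond (Var (Suc K)) p' p''"
  let ?P = "Seq (Asgn K (Var 0)) (Seq p (Seq (Asgn (Suc K) (Var 0)) (Seq (Asgn 0 (Var K)) ?C)))"
  let ?f = "\<lambda>d. if c d \<noteq> Nl then f d else g d"
  show ?thesis
  proof (rule fptimeI[where k = "K + 2" and p = ?P and q = "q + q' + q'' + [:10:]" and r = "q' + q''"])
    show "size (?f d) \<le> poly (q' + q'') (size d)" for d
      using computes_size[OF p', of d] computes_size[OF p'', of d] by simp
    fix s :: store
    let ?s1 = "s(K := s 0)"
    obtain t s2 where 1: "exec p ?s1 t s2" "s2 0 = c (?s1 0)" "\<forall>i\<ge>k. s2 i = ?s1 i"
      "t \<le> poly q (size (?s1 0))" using computesD[OF p, of ?s1] by blast
    let ?s3 = "s2(Suc K := s2 0, 0 := s2 K)"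
    obtain t' s4 where 2: "exec p' ?s3 t' s4" "s4 0 = f (?s3 0)" "\<forall>i\<ge>k'. s4 i = ?s3 i"
      "t' \<le> poly q' (size (?s3 0))" using computesD[OF p', of ?s3] by blast
    obtain t'' s5 where 3: "exec p'' ?s3 t'' s5" "s5 0 = g (?s3 0)" "\<forall>i\<ge>k''. s5 i = ?s3 i"
      "t'' \<le> poly q'' (size (?s3 0))" using computesD[OF p'', of ?s3] by blast
    \<comment> \<open>Both branch programs halt from \<open>?s3\<close>, so the store and time of
      the branch taken can be named uniformly and the bound summed over both.\<close>
    define S where "S = (if s2 0 \<noteq> Nl then s4 else s5)"
    define T where "T = (if s2 0 \<noteq> Nl then t' else t'')"
    have "exec ?C ?s3 (2 + T) S"
      using exec.CondTrue[of "Var (Suc K)" ?s3 p' t' s4 p''] 2(1)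
        exec.CondFalse[of "Var (Suc K)" ?s3 p'' t'' s5 p'] 3(1) K
      by (auto simp: S_def T_def)
    then have "exec ?P s (2 + (t + (2 + (2 + (2 + T))))) S"
      using exec.Asgn[of K "Var 0" s] exec.Asgn[of "Suc K" "Var 0" s2]
        exec.Asgn[of 0 "Var K" "s2(Suc K := s2 0)"] 1(1)
      by (intro exec.Seq) (simp_all add: numeral_eq_Suc)
    then show "\<exists>t s'. exec ?P s t s' \<and> s' 0 = ?f (s 0) \<and> (\<forall>i\<ge>K + 2. s' i = s i)
        \<and> t \<le> poly (q + q' + q'' + [:10:]) (size (s 0))"
      using 1 2 3 K by (intro exI conjI) (assumption, auto simp: S_def T_def)
  qed (use K in auto)
qed

section \<open>Loops as folds along the right spine\<close>

fun dapp :: "data \<Rightarrow> data \<Rightarrow> data" where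
  "dapp Nl ys = ys"
| "dapp (Node x xs) ys = Node x (dapp xs ys)"

fun dfold :: "(data \<Rightarrow> data \<Rightarrow> data) \<Rightarrow> data \<Rightarrow> data \<Rightarrow> data" where
  "dfold g Nl a = a"
| "dfold g (Node x xs) a = dfold g xs (g x a)"

lemma size_dapp [simp]: "size (dapp xs ys) = size xs + size ys"
  by (induction xs) auto

text \<open>Variable \<open>K\<close> holds the environment, \<open>K + 1\<close> the rest of the
  list and \<open>K + 2\<close> the accumulator. A program takes one argument, so element,
  accumulator and environment are packed into variable 0.\<close>

definition fold_body :: "nat \<Rightarrow> prog \<Rightarrow> prog" where
  "fold_body K p = Seq (Asgn 0 (Pair_E (Fst_E (Var (K + 1))) (Pair_E (Var (K + 2)) (Var K))))
     (Seq p (Seq (Asgn (K + 2) (Var 0)) (Asgn (K + 1) (Snd_E (Var (K + 1))))))"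

text \<open>The argument of each round contains the current accumulator, which is the fold over a
  prefix \<open>ys\<close> of \<open>xs\<close>; hence the bound \<open>B\<close> for all prefixes.
  \<open>N\<close> then bounds every argument, and 20 covers the test and the bookkeeping of one
  round.\<close>

lemma exec_fold_loop:
  assumes p: "computes p k q g" and K: "k \<le> K"
    and "s K = d" "s (K + 1) = xs" "s (K + 2) = a"
    and "\<And>ys zs. xs = dapp ys zs \<Longrightarrow> size (dfold (\<lambda>x a. g (Node x (Node a d))) ys a) \<le> B"
    and "size xs + size d + B + 2 \<le> N"
  shows "\<exists>t s'. exec (Loop (Var (K + 1)) (fold_body K p)) s t s'
    \<and> t \<le> size xs * (poly q N + 20) + 2
    \<and> s' (K + 2) = dfold (\<lambda>x a. g (Node x (Node a d))) xs a \<and> (\<forall>i\<ge>K + 3. s' i = s i)"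
  using assms(3-)
proof (induction xs arbitrary: s a)
  case Nl
  then show ?case
    using exec.LoopFalse[of "Var (K + 1)" s "fold_body K p"]
    by (intro exI[of _ 2] exI[of _ s]) (simp add: numeral_eq_Suc)
next
  case (Node x xs)
  have K0: "0 < K" using p K by (auto simp: computes_def)
  let ?s1 = "s(0 := Node x (Node a d))"
  obtain t s2 where 1: "exec p ?s1 t s2" "s2 0 = g (?s1 0)" "\<forall>i\<ge>k. s2 i = ?s1 i"
    "t \<le> poly q (size (?s1 0))" using computesD[OF p, of ?s1] by blast
  \<comment> \<open>A prefix \<open>ys\<close> of the tail corresponds to the prefix
    \<open>Node x ys\<close> of the whole list; the empty prefix bounds the current
    accumulator.\<close>
  have B: "size (dfold (\<lambda>x a. g (Node x (Node a d))) ys (g (Node x (Node a d)))) \<le> B"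
    if "xs = dapp ys zs" for ys zs
    using Node.prems(4)[of "Node x ys" zs] that by simp
  have "size a \<le> B" using Node.prems(4)[of Nl "Node x xs"] by simp
  then have "size (?s1 0) \<le> N" using Node.prems(5) by simp
  then have t: "t \<le> poly q N" using 1(4) poly_nat_mono order_trans by blast
  let ?s3 = "s2(K + 2 := s2 0, K + 1 := snd_data (s2 (K + 1)))"
  have "exec (fold_body K p) s (7 + (t + (2 + 3))) ?s3"
    using exec.Asgn[of 0 "Pair_E (Fst_E (Var (K + 1))) (Pair_E (Var (K + 2)) (Var K))" s]
      exec.Asgn[of "K + 2" "Var 0" s2]
      exec.Asgn[of "K + 1" "Snd_E (Var (K + 1))" "s2(K + 2 := s2 0)"] 1(1) Node.prems
    unfolding fold_body_def by (intro exec.Seq) (simp_all add: numeral_eq_Suc)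
  moreover have "\<exists>t s'. exec (Loop (Var (K + 1)) (fold_body K p)) ?s3 t s'
      \<and> t \<le> size xs * (poly q N + 20) + 2
      \<and> s' (K + 2) = dfold (\<lambda>x a. g (Node x (Node a d))) xs (g (Node x (Node a d)))
      \<and> (\<forall>i\<ge>K + 3. s' i = ?s3 i)"
    using Node.prems 1 K K0 B by (intro Node.IH) auto
  then obtain u s' where u: "exec (Loop (Var (K + 1)) (fold_body K p)) ?s3 u s'"
      "u \<le> size xs * (poly q N + 20) + 2"
      "s' (K + 2) = dfold (\<lambda>x a. g (Node x (Node a d))) xs (g (Node x (Node a d)))"
      "\<forall>i\<ge>K + 3. s' i = ?s3 i" by blast
  ultimately have "exec (Loop (Var (K + 1)) (fold_body K p)) s
      (expr_cost (Var (K + 1)) + 1 + (7 + (t + (2 + 3))) + u) s'"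
    using Node.prems by (intro exec.LoopTrue) auto
  moreover have "expr_cost (Var (K + 1)) + 1 + (7 + (t + (2 + 3))) + u \<le> size (Node x xs) * (poly q N + 20) + 2"
  proof -
    have "size xs * (poly q N + 20) + poly q N + 20 \<le> size (Node x xs) * (poly q N + 20)"
      by (simp add: algebra_simps)
    moreover have "expr_cost (Var (K + 1)) = 1" by simp
    ultimately show ?thesis using t u(2) by linarith
  qed
  moreover have "s' (K + 2) = dfold (\<lambda>x a. g (Node x (Node a d))) (Node x xs) a" using u(3) by simp
  moreover have "\<forall>i\<ge>K + 3. s' i = s i" using u(4) 1(3) K K0 by simp
  ultimately show ?case by blast
qed

text \<open>\<open>bound\<close> ranges over all \<open>xs\<close>, not only \<open>l d\<close>, so
  that it covers the prefixes of \<open>l d\<close> and hence every accumulator that the loop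
  meets.\<close>

lemma fptime_dfold_bounded:
  fixes Q :: "nat poly"
  assumes "fptime (\<lambda>e. G (fst_data e) (fst_data (snd_data e)) (snd_data (snd_data e)))"
    and "fptime l" "fptime a"
    and bound: "\<And>d xs. size (dfold (\<lambda>x a. G x a d) xs (a d)) \<le> poly Q (size xs + size d)"
  shows "fptime (\<lambda>d. dfold (\<lambda>x a. G x a d) (l d) (a d))"
proof -
  let ?g = "\<lambda>e. G (fst_data e) (fst_data (snd_data e)) (snd_data (snd_data e))"
  obtain p k q where p: "computes p k q ?g" using assms(1) unfolding fptime_def by blast
  obtain p' k' q' where p': "computes p' k' q' l" using assms(2) unfolding fptime_def by blast
  obtain p'' k'' q'' where p'': "computes p'' k'' q'' a" using assms(3) unfolding fptime_def by blast
  define K where "K = max k (max k' k'')"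
  have K: "k \<le> K" "k' \<le> K" "k'' \<le> K" "0 < K" using p by (auto simp: K_def computes_def)
  let ?L = "Loop (Var (K + 1)) (fold_body K p)"
  let ?P = "Seq (Asgn K (Var 0)) (Seq p' (Seq (Asgn (K + 1) (Var 0)) (Seq (Asgn 0 (Var K))
     (Seq p'' (Seq (Asgn (K + 2) (Var 0)) (Seq ?L (Asgn 0 (Var (K + 2)))))))))"
  let ?f = "\<lambda>d. dfold (\<lambda>x a. G x a d) (l d) (a d)"
  \<comment> \<open>\<open>R\<close> bounds the accumulators in terms of the size of
    \<open>d\<close>, and \<open>N\<close> bounds the packed argument of each round.\<close>
  define R where "R = pcompose Q (q' + [:0, 1:])"
  define N where "N = q' + [:2, 1:] + R"
  have R: "size (dfold (\<lambda>x a. G x a d) xs (a d)) \<le> poly R (size d)"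
    if "size xs \<le> size (l d)" for xs d :: data
    using bound[of d xs] computes_size[OF p', of d] that
      poly_nat_mono[of "size xs + size d" "poly q' (size d) + size d" Q]
    by (simp add: R_def poly_pcompose)
  show ?thesis
  proof (rule fptimeI[where k = "K + 3" and p = ?P
        and q = "q' + q'' + [:20:] + q' * (pcompose q N + [:20:])" and r = R])
    show "size (?f d) \<le> poly R (size d)" for d
      by (rule R) simp
    fix s :: store
    let ?d = "s 0"
    let ?s1 = "s(K := s 0)"
    obtain t1 s2 where 1: "exec p' ?s1 t1 s2" "s2 0 = l (?s1 0)" "\<forall>i\<ge>k'. s2 i = ?s1 i"
      "t1 \<le> poly q' (size (?s1 0))" using computesD[OF p', of ?s1] by blast
    let ?s3 = "s2(K + 1 := s2 0, 0 := s2 K)"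
    obtain t2 s4 where 2: "exec p'' ?s3 t2 s4" "s4 0 = a (?s3 0)" "\<forall>i\<ge>k''. s4 i = ?s3 i"
      "t2 \<le> poly q'' (size (?s3 0))" using computesD[OF p'', of ?s3] by blast
    let ?s5 = "s4(K + 2 := s4 0)"
    have "\<exists>t s'. exec ?L ?s5 t s'
      \<and> t \<le> size (l ?d) * (poly q (poly N (size ?d)) + 20) + 2
      \<and> s' (K + 2) = dfold (\<lambda>x a. ?g (Node x (Node a ?d))) (l ?d) (a ?d) \<and> (\<forall>i\<ge>K + 3. s' i = ?s5 i)"
    proof (rule exec_fold_loop[OF p K(1)])
      show "size (dfold (\<lambda>x a. ?g (Node x (Node a ?d))) ys (a ?d)) \<le> poly R (size ?d)"
        if "l ?d = dapp ys zs" for ys zs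
        using R[of ys ?d] that by simp
      show "size (l ?d) + size ?d + poly R (size ?d) + 2 \<le> poly N (size ?d)"
        using computes_size[OF p', of ?d] by (simp add: N_def)
    qed (use 1 2 K in auto)
    then obtain t3 s6 where 3: "exec ?L ?s5 t3 s6"
      "t3 \<le> size (l ?d) * (poly q (poly N (size ?d)) + 20) + 2"
      "s6 (K + 2) = ?f ?d" "\<forall>i\<ge>K + 3. s6 i = ?s5 i" by auto
    have "t3 \<le> poly (q' * (pcompose q N + [:20:])) (size ?d) + 2"
    proof -
      have "poly (q' * (pcompose q N + [:20:])) (size ?d)
          = poly q' (size ?d) * (poly q (poly N (size ?d)) + 20)"
        by (simp add: poly_pcompose)
      then show ?thesis
        using 3(2) mult_le_mono1[OF computes_size[OF p', of ?d],
            of "poly q (poly N (size ?d)) + 20"] by linarith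
    qed
    moreover have "exec ?P s (2 + (t1 + (2 + (2 + (t2 + (2 + (t3 + 2))))))) (s6(0 := s6 (K + 2)))"
      using exec.Asgn[of K "Var 0" s] exec.Asgn[of "K + 1" "Var 0" s2]
        exec.Asgn[of 0 "Var K" "s2(K + 1 := s2 0)"] exec.Asgn[of "K + 2" "Var 0" s4]
        exec.Asgn[of 0 "Var (K + 2)" s6] 1(1) 2(1) 3(1)
      by (intro exec.Seq) (simp_all add: numeral_eq_Suc)
    ultimately show "\<exists>t s'. exec ?P s t s' \<and> s' 0 = ?f ?d \<and> (\<forall>i\<ge>K + 3. s' i = s i)
        \<and> t \<le> poly (q' + q'' + [:20:] + q' * (pcompose q N + [:20:])) (size ?d)"
      using 1 2 3 K by (intro exI conjI) (assumption, auto)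
  qed (use K in auto)
qed

lemma size_dfold_additive:
  assumes "\<And>x a. size x \<le> N \<Longrightarrow> size (g x a) \<le> size a + B"
    and "size xs \<le> N"
  shows "size (dfold g xs a) \<le> size a + size xs * B"
  using assms(2)
proof (induction xs arbitrary: a)
  case (Node x xs)
  then have "size (dfold g xs (g x a)) \<le> size (g x a) + size xs * B" by simp
  moreover have "size (g x a) \<le> size a + B" using Node.prems by (intro assms(1)) simp
  ultimately show ?case by (simp add: algebra_simps)
qed simp

text \<open>Increments bounded independently of the accumulator add up to at most a product of
  polynomials, whereas an accumulator that doubles in each round would grow exponentially.\<close>

lemma fptime_dfold:
  fixes Q :: "nat poly"
  assumes "fptime (\<lambda>e. G (fst_data e) (fst_data (snd_data e)) (snd_data (snd_data e)))"
    and "fptime l" "fptime a"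
    and grow: "\<And>x a d. size (G x a d) \<le> size a + poly Q (size x + size d)"
  shows "fptime (\<lambda>d. dfold (\<lambda>x a. G x a d) (l d) (a d))"
proof -
  obtain q where q: "\<And>d. size (a d) \<le> poly q (size d)" using fptime_size[OF assms(3)] by blast
  show ?thesis
  \<comment> \<open>The polynomial adds the bound on the initial accumulator to the number of
    elements times the increment.\<close>
  proof (rule fptime_dfold_bounded[OF assms(1-3), where Q = "q + [:0, 1:] * Q"])
    fix d xs :: data
    let ?N = "size xs + size d"
    have "size (dfold (\<lambda>x a. G x a d) xs (a d)) \<le> size (a d) + size xs * poly Q ?N"
    proof (rule size_dfold_additive)
      show "size (G x a d) \<le> size a + poly Q ?N" if "size x \<le> size xs" for x a
        using grow[of x a d] poly_nat_mono[of "size x + size d" ?N Q] that by simp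
    qed simp
    moreover have "size (a d) \<le> poly q ?N"
      using q[of d] poly_nat_mono[of "size d" ?N q] by simp
    moreover have "size xs * poly Q ?N \<le> ?N * poly Q ?N" by (intro mult_le_mono1) simp
    moreover have "poly (q + [:0, 1:] * Q) ?N = poly q ?N + ?N * poly Q ?N" by simp
    ultimately show "size (dfold (\<lambda>x a. G x a d) xs (a d)) \<le> poly (q + [:0, 1:] * Q) ?N"
      by linarith
  qed
qed

section \<open>List operations\<close>

text \<open>
  Trees are read as lists along their right spine, as in \<^const>\<open>enc_list\<close>, and \<^const>\<open>Nl\<close> is read
  as false. In the rules below, \<open>d\<close> is the environment, which the body of a list operation receives
  paired with the list element.
\<close>

fun dmap :: "(data \<Rightarrow> data) \<Rightarrow> data \<Rightarrow> data" where
  "dmap g Nl = Nl"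
| "dmap g (Node x xs) = Node (g x) (dmap g xs)"

definition drev :: "data \<Rightarrow> data" where
  "drev xs = dfold Node xs Nl"

lemma drev_simps: "drev Nl = Nl" "drev (Node x xs) = dapp (drev xs) (Node x Nl)"
proof -
  have *: "dfold Node xs (dapp ys zs) = dapp (dfold Node xs ys) zs" for xs ys zs
    by (induction xs arbitrary: ys) (simp_all flip: dapp.simps(2))
  show "drev Nl = Nl" "drev (Node x xs) = dapp (drev xs) (Node x Nl)"
    using *[of xs Nl "Node x Nl"] by (simp_all add: drev_def)
qed

lemma dfold_dapp: "dfold g (dapp xs ys) a = dfold g ys (dfold g xs a)"
  by (induction xs arbitrary: a) auto

text \<open>\<open>dfold\<close> consumes its list from the front and \<open>Node\<close> adds at
  the front, which reverses the order; reversing the list first compensates. The same holds for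
  \<open>dmap\<close>.\<close>

lemma dapp_eq_dfold: "dapp xs ys = dfold Node (drev xs) ys"
  by (induction xs arbitrary: ys) (auto simp: drev_simps dfold_dapp)

lemma dmap_eq_dfold: "dmap g xs = dfold (\<lambda>x a. Node (g x) a) (drev xs) Nl"
  by (induction xs) (auto simp: drev_simps dfold_dapp)

lemma fptime_dfold_Node:
  assumes "fptime (\<lambda>e. g (fst_data e) (snd_data e))" "fptime l" "fptime a"
  shows "fptime (\<lambda>d. dfold (\<lambda>x a. Node (g x d) a) (l d) (a d))"
proof -
  obtain q where q: "\<And>e. size (g (fst_data e) (snd_data e)) \<le> poly q (size e)"
    using fptime_size[OF assms(1)] by blast
  \<comment> \<open>The fold step receives element, accumulator and environment; \<open>?h\<close>
    drops the accumulator, leaving the pair that \<open>g\<close> expects.\<close>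
  let ?h = "\<lambda>e. Node (fst_data e) (snd_data (snd_data e))"
  have h: "fptime ?h" by (intro fptime_Node fptime_fst fptime_snd fptime_id)
  have "fptime (\<lambda>e. g (fst_data (?h e)) (snd_data (?h e)))"
    by (rule fptime_comp[OF h assms(1)])
  then have "fptime (\<lambda>e. g (fst_data e) (snd_data (snd_data e)))" by simp
  then have 1: "fptime (\<lambda>e. Node (g (fst_data e) (snd_data (snd_data e))) (fst_data (snd_data e)))"
    by (intro fptime_Node fptime_fst fptime_snd fptime_id)
  show ?thesis
  proof (rule fptime_dfold[OF 1 assms(2,3), where Q = "pcompose q [:1, 1:] + 1"])
    show "size (Node (g x d) a) \<le> size a + poly (pcompose q [:1, 1:] + 1) (size x + size d)" for x a d
      using q[of "Node x d"] by (simp add: poly_pcompose)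
  qed
qed

lemma fptime_drev:
  assumes "fptime l"
  shows "fptime (\<lambda>d. drev (l d))"
  unfolding drev_def using fptime_dfold_Node[OF fptime_fst_data assms fptime_Nl] by simp

lemma fptime_dapp:
  assumes "fptime f" "fptime g"
  shows "fptime (\<lambda>d. dapp (f d) (g d))"
  unfolding dapp_eq_dfold
  using fptime_dfold_Node[OF fptime_fst_data fptime_drev[OF assms(1)] assms(2)] by simp

lemma fptime_dmap:
  assumes "fptime (\<lambda>e. g (fst_data e) (snd_data e))" "fptime l"
  shows "fptime (\<lambda>d. dmap (\<lambda>x. g x d) (l d))"
  unfolding dmap_eq_dfold
  using fptime_dfold_Node[OF assms(1) fptime_drev[OF assms(2)] fptime_Nl] by simp

abbreviation dtrue :: data where
  "dtrue \<equiv> Node Nl Nl"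

abbreviation dif :: "data \<Rightarrow> data \<Rightarrow> data \<Rightarrow> data" where
  "dif c a b \<equiv> (if c \<noteq> Nl then a else b)"

definition dex :: "(data \<Rightarrow> data) \<Rightarrow> data \<Rightarrow> data" where
  "dex g xs = dfold (\<lambda>x a. dif (g x) dtrue a) xs Nl"

lemma fptime_dex:
  assumes "fptime (\<lambda>e. g (fst_data e) (snd_data e))" "fptime l"
  shows "fptime (\<lambda>d. dex (\<lambda>x. g x d) (l d))"
proof -
  let ?h = "\<lambda>e. Node (fst_data e) (snd_data (snd_data e))"
  have h: "fptime ?h" by (intro fptime_Node fptime_fst fptime_snd fptime_id)
  have "fptime (\<lambda>e. g (fst_data (?h e)) (snd_data (?h e)))"
    by (rule fptime_comp[OF h assms(1)])
  then have "fptime (\<lambda>e. g (fst_data e) (snd_data (snd_data e)))" by simp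
  then have 1: "fptime (\<lambda>e. dif (g (fst_data e) (snd_data (snd_data e))) dtrue (fst_data (snd_data e)))"
    by (intro fptime_if fptime_Node fptime_Nl fptime_fst fptime_snd fptime_id)
  show ?thesis
    unfolding dex_def
    by (rule fptime_dfold[OF 1 assms(2) fptime_Nl, where Q = 1]) auto
qed

lemma dex_enc_list:
  "dex g (enc_list f xs) = enc_bool (\<exists>x\<in>set xs. g (f x) \<noteq> Nl)"
proof -
  \<comment> \<open>An arbitrary truth value as accumulator makes the induction go through: once
    true, it stays true.\<close>
  have "dfold (\<lambda>x a. dif (g x) dtrue a) (enc_list f xs) (enc_bool b)
      = enc_bool (b \<or> (\<exists>x\<in>set xs. g (f x) \<noteq> Nl))" for b
  proof (induction xs arbitrary: b)
    case (Cons x xs)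
    show ?case using Cons[of True] Cons[of b] by auto
  qed simp
  from this[of False] show ?thesis by (simp add: dex_def)
qed

lemma dapp_enc_list: "dapp (enc_list f xs) (enc_list f ys) = enc_list f (xs @ ys)"
  by (induction xs) auto

lemma dmap_enc_list: "dmap g (enc_list f xs) = enc_list (\<lambda>x. g (f x)) xs"
  by (induction xs) auto

lemma enc_list_map: "enc_list f (map g xs) = enc_list (\<lambda>x. f (g x)) xs"
  by (induction xs) auto

lemma enc_list_cong: "(\<And>x. x \<in> set xs \<Longrightarrow> f x = g x) \<Longrightarrow> enc_list f xs = enc_list g xs"
  by (induction xs) auto

lemma dapp_enc_nat: "dapp (enc_nat m) (enc_nat n) = enc_nat (m + n)"
  by (induction m) auto

text \<open>Unary subtraction of \<open>x\<close> from \<open>y\<close>, one unit per round. An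
  accumulator \<open>Node Nl z\<close> says that \<open>z\<close> is left, while \<open>Nl\<close>
  says that \<open>y\<close> was exhausted too early; the numbers are equal iff the end is reached
  with nothing left.\<close>

definition dnat_eq :: "data \<Rightarrow> data \<Rightarrow> data" where
  "dnat_eq x y = (let z = dfold (\<lambda>_ a. dif (snd_data a) (Node Nl (snd_data (snd_data a))) Nl) x (Node Nl y)
     in dif z (dif (snd_data z) Nl dtrue) Nl)"

lemma dnat_eq_enc_nat: "dnat_eq (enc_nat m) (enc_nat n) = enc_bool (m = n)"
proof -
  let ?g = "\<lambda>_ a. dif (snd_data a) (Node Nl (snd_data (snd_data a))) Nl"
  have 1: "dfold ?g (enc_nat m) Nl = Nl" for m
    by (induction m) auto
  have "dfold ?g (enc_nat m) (Node Nl (enc_nat n))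
      = (if m \<le> n then Node Nl (enc_nat (n - m)) else Nl)"
  proof (induction m arbitrary: n)
    case (Suc m)
    show ?case using Suc 1 by (cases n) auto
  qed simp
  moreover have "enc_nat k = Nl \<longleftrightarrow> k = 0" for k by (cases k) auto
  ultimately show ?thesis by (auto simp: dnat_eq_def Let_def)
qed

lemma fptime_dnat_eq:
  assumes "fptime f" "fptime g"
  shows "fptime (\<lambda>d. dnat_eq (f d) (g d))"
proof -
  have 1: "fptime (\<lambda>d. dfold (\<lambda>_ a. dif (snd_data a) (Node Nl (snd_data (snd_data a))) Nl)
    (f d) (Node Nl (g d)))"
  proof (rule fptime_dfold[where Q = 1])
    show "size (dif (snd_data a) (Node Nl (snd_data (snd_data a))) Nl)
        \<le> size a + poly 1 (size (x::data) + size (d::data))" for x a d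
      using size_snd_data_le[of a] size_snd_data_le[of "snd_data a"] by (auto simp: le_SucI)
  qed (intro fptime_if fptime_Node fptime_Nl fptime_fst fptime_snd fptime_id assms)+
  show ?thesis
    unfolding dnat_eq_def Let_def
    by (intro fptime_if 1 fptime_Node fptime_Nl fptime_fst fptime_snd fptime_id)
qed

text \<open>Only the length of \<open>xs\<close> matters. Each round prepends the successor of the
  head, or zero at the start, so the numbers arise in descending order and are reversed at the
  end.\<close>

definition dupto :: "data \<Rightarrow> data" where
  "dupto xs = drev (dfold (\<lambda>_ a. Node (dif a (Node Nl (fst_data a)) Nl) a) xs Nl)"

lemma dfold_dupto:
  "dfold (\<lambda>_ a. Node (dif a (Node Nl (fst_data a)) Nl) a) (enc_list f xs) Nl
    = enc_list enc_nat (rev [0..<length xs])"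
proof (induction xs rule: rev_induct)
  case (snoc x xs)
  have "enc_list f (xs @ [x]) = dapp (enc_list f xs) (Node (f x) Nl)"
    using dapp_enc_list[of f xs "[x]"] by simp
  then show ?case using snoc by (cases "length xs") (auto simp: dfold_dapp)
qed simp

lemma drev_enc_list: "drev (enc_list f xs) = enc_list f (rev xs)"
proof (induction xs)
  case (Cons x xs)
  then show ?case using dapp_enc_list[of f "rev xs" "[x]"] by (simp add: drev_simps)
qed (simp add: drev_simps)

lemma dupto_enc_list: "dupto (enc_list f xs) = enc_list enc_nat [0..<length xs]"
  by (simp add: dupto_def dfold_dupto drev_enc_list)

text \<open>The right spine makes every tree a list encoding, so equations about
  \<open>enc_list\<close> yield bounds on arbitrary trees, as \<open>fptime\<close>
  requires.\<close>

lemma ex_enc_list: "\<exists>ys. xs = enc_list (\<lambda>x. x) ys \<and> length ys \<le> size xs"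
proof (induction xs)
  case (Node x xs)
  then obtain ys where "xs = enc_list (\<lambda>x. x) ys" "length ys \<le> size xs" by blast
  then show ?case by (intro exI[of _ "x # ys"]) auto
qed (auto intro: exI[of _ "[]"])

lemma size_enc_nat [simp]: "size (enc_nat n) = n"
  by (induction n) auto

lemma size_enc_list: "size (enc_list f xs) = (\<Sum>x\<leftarrow>xs. size (f x) + 1)"
  by (induction xs) auto

text \<open>\<open>fptime_dfold\<close> does not apply, since a round adds a copy of the
  accumulator's head. The closed form of the fold gives a quadratic size bound instead.\<close>

lemma fptime_dupto:
  assumes "fptime l"
  shows "fptime (\<lambda>d. dupto (l d))"
  unfolding dupto_def
proof (intro fptime_drev fptime_dfold_bounded[where Q = "[:0, 1:] * [:1, 1:]"])
  fix d xs :: data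
  obtain ys where ys: "xs = enc_list (\<lambda>x. x) ys" "length ys \<le> size xs" using ex_enc_list by blast
  have "size (enc_list enc_nat (rev [0..<length ys])) = (\<Sum>x\<leftarrow>rev [0..<length ys]. x + 1)"
    by (simp add: size_enc_list)
  also have "\<dots> \<le> (\<Sum>x\<leftarrow>rev [0..<length ys]. length ys + 1)"
    by (rule sum_list_mono) auto
  also have "\<dots> = length ys * (length ys + 1)" by (simp add: sum_list_triv)
  also have "\<dots> \<le> (size xs + size d) * (size xs + size d + 1)"
    using ys(2) by (intro mult_le_mono) auto
  finally show "size (dfold (\<lambda>_ a. Node (dif a (Node Nl (fst_data a)) Nl) a) xs Nl)
      \<le> poly ([:0, 1:] * [:1, 1:]) (size xs + size d)"
    by (simp add: ys(1) dfold_dupto algebra_simps)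
qed (intro fptime_if fptime_Node fptime_Nl fptime_fst fptime_snd fptime_id assms)+

section \<open>Transfer of running times along a reduction\<close>

lemma exec_clear:
  "\<exists>p. \<forall>s. exec p s (2 * k + 2) (\<lambda>i. if 0 < i \<and> i \<le> k then Nl else s i)"
proof (induction k)
  case 0
  \<comment> \<open>Assigning variable 0 to itself is a no-op of cost 2; it serves as the empty
    program and accounts for the constant in the bound.\<close>
  have "exec (Asgn 0 (Var 0)) s (Suc (Suc 0)) s" for s
    using exec.Asgn[of 0 "Var 0" s] by simp
  moreover have "(\<lambda>i. if 0 < i \<and> i \<le> 0 then Nl else s i) = s" for s :: store
    by (auto simp: fun_eq_iff)
  ultimately show ?case by (metis add_0 mult_0_right numeral_2_eq_2)
next
  case (Suc k)
  then obtain p where p: "\<And>s. exec p s (2 * k + 2) (\<lambda>i. if 0 < i \<and> i \<le> k then Nl else s i)"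
    by blast
  have "exec (Seq p (Asgn (Suc k) Nil_E)) s (2 * k + 2 + (expr_cost Nil_E + 1))
      ((\<lambda>i. if 0 < i \<and> i \<le> k then Nl else s i)(Suc k := eval_expr Nil_E (\<lambda>i. if 0 < i \<and> i \<le> k then Nl else s i)))"
    for s by (rule exec.Seq[OF p exec.Asgn])
  moreover have "(\<lambda>i. if 0 < i \<and> i \<le> k then Nl else s i)(Suc k := Nl)
      = (\<lambda>i. if 0 < i \<and> i \<le> Suc k then Nl else s i)" for s :: store
    by (auto simp: fun_eq_iff)
  ultimately show ?case by (intro exI[of _ "Seq p (Asgn (Suc k) Nil_E)"]) simp
qed

lemma solvable_within_mono:
  assumes "solvable_within X Q enc T" "\<And>x. x \<in> X \<Longrightarrow> T x \<le> T' x"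
  shows "solvable_within X Q enc T'"
  using assms unfolding solvable_within_def by (meson order_trans)

text \<open>The time of the reduction is added to the time at \<open>red x\<close>, not multiplied
  with it, so the base and exponent of an exponential factor of \<open>T\<close> are inherited
  unchanged.\<close>

lemma solvable_within_reduction:
  assumes "fptime F"
    and red: "\<And>x. x \<in> X \<Longrightarrow> red x \<in> Y" "\<And>x. x \<in> X \<Longrightarrow> encY (red x) = F (encX x)"
      "\<And>x. x \<in> X \<Longrightarrow> R (red x) \<longleftrightarrow> Q x"
    and "solvable_within Y R encY T"
  shows "\<exists>q :: nat poly. solvable_within X Q encX (\<lambda>x. real (poly q (size (encX x))) + T (red x))"
proof -
  obtain p k q where p: "computes p k q F" using assms(1) unfolding fptime_def by blast
  \<comment> \<open>\<open>p\<close> may leave garbage in its scratch variables, while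
    \<open>p'\<close> is only known to be correct from \<open>init_store\<close>; \<open>c\<close>
    clears them in between.\<close>
  obtain c where c: "\<And>s. exec c s (2 * k + 2) (\<lambda>i. if 0 < i \<and> i \<le> k then Nl else s i)"
    using exec_clear by blast
  obtain p' where p': "\<And>y. y \<in> Y \<Longrightarrow>
      \<exists>t s. exec p' (init_store (encY y)) t s \<and> (s 0 \<noteq> Nl \<longleftrightarrow> R y) \<and> real t \<le> T y"
    using assms(5) unfolding solvable_within_def by blast
  have "\<exists>t s. exec (Seq p (Seq c p')) (init_store (encX x)) t s \<and> (s 0 \<noteq> Nl \<longleftrightarrow> Q x)
      \<and> real t \<le> real (poly (q + [:2 * k + 2:]) (size (encX x))) + T (red x)" if x: "x \<in> X" for x
  proof -
    let ?s = "init_store (encX x)"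
    obtain t1 s1 where 1: "exec p ?s t1 s1" "s1 0 = F (?s 0)" "\<forall>i\<ge>k. s1 i = ?s i"
      "t1 \<le> poly q (size (?s 0))" using computesD[OF p, of ?s] by blast
    have "(\<lambda>i. if 0 < i \<and> i \<le> k then Nl else s1 i) = init_store (encY (red x))"
      using 1(2,3) red(2)[OF x] by (auto simp: fun_eq_iff init_store_def)
    then have 2: "exec c s1 (2 * k + 2) (init_store (encY (red x)))" using c[of s1] by simp
    obtain t3 s3 where 3: "exec p' (init_store (encY (red x))) t3 s3" "s3 0 \<noteq> Nl \<longleftrightarrow> R (red x)"
      "real t3 \<le> T (red x)" using p'[OF red(1)[OF x]] by blast
    have "exec (Seq p (Seq c p')) ?s (t1 + (2 * k + 2 + t3)) s3"
      by (rule exec.Seq[OF 1(1) exec.Seq[OF 2 3(1)]])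
    moreover have "real t1 \<le> real (poly q (size (encX x)))"
      using 1(4) by (simp add: init_store_def)
    ultimately show ?thesis using 3 red(3)[OF x]
      by (intro exI conjI) (assumption, auto)
  qed
  then show ?thesis unfolding solvable_within_def by blast
qed

section \<open>From CNF-SAT to Colorful Graph Motif\<close>

text \<open>
  With \<open>r\<close> variables and \<open>m\<close> clauses, vertex \<open>x < r\<close> is the literal \<open>x\<close>, vertex \<open>r + x\<close> its negation,
  vertex \<open>2 r + j\<close> the clause \<open>j\<close>, and vertex \<open>2 r + m\<close> the root.
\<close>

definition vertex_literal :: "nat \<Rightarrow> nat \<Rightarrow> literal" where
  "vertex_literal r v = (if v < r then (v, True) else (v - r, False))"

definition literal_edge :: "cnf \<Rightarrow> nat \<Rightarrow> nat \<Rightarrow> bool" where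
  "literal_edge \<Phi> u v \<longleftrightarrow> (let r = num_vars \<Phi>; m = length \<Phi> in
     u < 2 * r \<and> (v = 2 * r + m \<or> (\<exists>j<m. v = 2 * r + j \<and> vertex_literal r u \<in> set (\<Phi> ! j))))"

text \<open>Subtracting \<open>r\<close> gives both literals of a variable the same color and sends
  clauses and root to the private colors from \<open>r\<close> to \<open>r + m\<close>.
  \<open>literal_edge\<close> points away from literals only, so both orientations are
  taken.\<close>

definition cnf_to_cgm :: "cnf \<Rightarrow> cgm" where
  "cnf_to_cgm \<Phi> = (let r = num_vars \<Phi>; m = length \<Phi> in
     \<lparr> cgm_motif = {..<r + m + 1},
       cgm_graph = \<lparr> pverts = {..<2 * r + m + 1},
         parcs = {(u, v). literal_edge \<Phi> u v \<or> literal_edge \<Phi> v u} \<rparr>,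
       cgm_coloring = (\<lambda>v. if v < r then v else v - r) \<rparr>)"

section \<open>Well-formedness and correctness of the constructed instance\<close>

lemma cgm_verts_cnf_to_cgm: "cgm_verts (cnf_to_cgm \<Phi>) = {..<2 * num_vars \<Phi> + length \<Phi> + 1}"
  by (simp add: cnf_to_cgm_def cgm_verts_def Let_def)

lemma cgm_motif_cnf_to_cgm: "cgm_motif (cnf_to_cgm \<Phi>) = {..<num_vars \<Phi> + length \<Phi> + 1}"
  by (simp add: cnf_to_cgm_def Let_def)

lemma cgm_coloring_cnf_to_cgm:
  "cgm_coloring (cnf_to_cgm \<Phi>) v = (if v < num_vars \<Phi> then v else v - num_vars \<Phi>)"
  by (simp add: cnf_to_cgm_def Let_def)

lemma parcs_cnf_to_cgm:
  "parcs (cgm_graph (cnf_to_cgm \<Phi>)) = {(u, v). literal_edge \<Phi> u v \<or> literal_edge \<Phi> v u}"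
  by (simp add: cnf_to_cgm_def Let_def)

lemma cgm_colors_cnf_to_cgm: "cgm_colors (cnf_to_cgm \<Phi>) = {..<num_vars \<Phi> + length \<Phi> + 1}"
  by (auto simp: cgm_colors_def cgm_verts_cnf_to_cgm cgm_motif_cnf_to_cgm cgm_coloring_cnf_to_cgm)

lemma cgm_param_cnf_to_cgm: "cgm_param (cnf_to_cgm \<Phi>) = num_vars \<Phi>"
  by (simp add: cgm_param_def cgm_verts_cnf_to_cgm cgm_motif_cnf_to_cgm)

lemma pair_graph_cnf_to_cgm: "pair_graph (cgm_graph (cnf_to_cgm \<Phi>))" (is "pair_graph ?G")
proof -
  have verts: "pverts ?G = {..<2 * num_vars \<Phi> + length \<Phi> + 1}"
    using cgm_verts_cnf_to_cgm[of \<Phi>] by (simp add: cgm_verts_def)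
  have sub: "parcs ?G \<subseteq> pverts ?G \<times> pverts ?G"
    by (auto simp: verts parcs_cnf_to_cgm literal_edge_def Let_def)
  show ?thesis
  proof
    show "fst e \<in> pverts ?G" "snd e \<in> pverts ?G" if "e \<in> parcs ?G" for e
      using sub that by auto
    show "finite (pverts ?G)" by (simp add: verts)
    then show "finite (parcs ?G)" using sub finite_subset by blast
    show "symmetric ?G" by (auto simp: symmetric_def sym_def parcs_cnf_to_cgm)
    show "fst e \<noteq> snd e" if "e \<in> parcs ?G" for e
      using that by (auto simp: parcs_cnf_to_cgm literal_edge_def Let_def)
  qed
qed

lemma cnf_to_cgm_instance: "cnf_to_cgm \<Phi> \<in> cgm_instances"
  by (simp add: cgm_instances_def pair_graph_cnf_to_cgm cgm_verts_cnf_to_cgm cgm_motif_cnf_to_cgm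
      cgm_colors_cnf_to_cgm)

text \<open>Connectedness is strong connectedness of the symmetric closure, which adds no arcs to a
  symmetric graph; what remains is reachability inside \<open>S\<close>.\<close>

lemma connected_induce_iff:
  assumes "symmetric (with_proj G)"
  shows "Digraph_Component.connected (with_proj G \<restriction> S) \<longleftrightarrow>
    S \<noteq> {} \<and> (\<forall>u\<in>S. \<forall>v\<in>S. (u, v) \<in> rtrancl_on S {(x, y) \<in> parcs G. x \<in> S \<and> y \<in> S})"
proof -
  have "parcs (mk_symmetric (with_proj G \<restriction> S)) = {(x, y) \<in> parcs G. x \<in> S \<and> y \<in> S}"
    using assms by (auto simp: parcs_mk_symmetric symmetric_def sym_def induce_subgraph_def)
  then show ?thesis
    by (auto simp: Digraph_Component.connected_def strongly_connected_def reachable_def)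
qed

lemma cgm_solvable_cnf_to_cgm:
  assumes "\<Phi> \<in> cnf_instances"
  shows "cgm_solvable (cnf_to_cgm \<Phi>) \<longleftrightarrow> cnf_satisfiable \<Phi>"
proof -
  define r m where "r = num_vars \<Phi>" and "m = length \<Phi>"
  define I where "I = cnf_to_cgm \<Phi>"
  define col :: "nat \<Rightarrow> nat" where "col = (\<lambda>v. if v < r then v else v - r)"
  define E where "E = (\<lambda>S. {(x, y) \<in> parcs (cgm_graph I). x \<in> S \<and> y \<in> S})"
  have vars: "x < r" if "C \<in> set \<Phi>" "(x, b) \<in> set C" for C x b
    using assms that by (force simp: cnf_instances_def cnf_vars_def r_def)
  have arc: "(u, v) \<in> parcs (cgm_graph I) \<longleftrightarrow> literal_edge \<Phi> u v \<or> literal_edge \<Phi> v u" for u v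
    by (simp add: I_def parcs_cnf_to_cgm)
  have edge: "literal_edge \<Phi> u v \<longleftrightarrow> u < 2 * r \<and>
      (v = 2 * r + m \<or> (\<exists>j<m. v = 2 * r + j \<and> vertex_literal r u \<in> set (\<Phi> ! j)))" for u v
    by (simp add: literal_edge_def r_def m_def Let_def)
  have sym: "symmetric (with_proj (cgm_graph I))"
    using pair_graph_cnf_to_cgm[of \<Phi>] unfolding I_def
    by (auto simp: symmetric_def sym_def parcs_cnf_to_cgm)
  \<comment> \<open>The map \<open>f\<close> is determined on \<open>S\<close> by the coloring, so
    \<open>col\<close> itself can be required to be the bijection.\<close>
  have solvable: "cgm_solvable I \<longleftrightarrow> (\<exists>S\<subseteq>{..<2 * r + m + 1}. S \<noteq> {} \<and>
      (\<forall>u\<in>S. \<forall>v\<in>S. (u, v) \<in> rtrancl_on S (E S)) \<and> bij_betw col S {..<r + m + 1})"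
  proof -
    have "(\<exists>f. bij_betw f S (cgm_motif I) \<and> (\<forall>v\<in>S. f v = cgm_coloring I v)) \<longleftrightarrow>
        bij_betw col S {..<r + m + 1}" for S
    proof
      assume "\<exists>f. bij_betw f S (cgm_motif I) \<and> (\<forall>v\<in>S. f v = cgm_coloring I v)"
      then obtain f where "bij_betw f S (cgm_motif I)" "\<forall>v\<in>S. f v = col v"
        by (auto simp: I_def col_def cgm_coloring_cnf_to_cgm r_def)
      then show "bij_betw col S {..<r + m + 1}"
        using bij_betw_cong[of S f col] by (simp add: I_def cgm_motif_cnf_to_cgm r_def m_def)
    next
      assume "bij_betw col S {..<r + m + 1}"
      then show "\<exists>f. bij_betw f S (cgm_motif I) \<and> (\<forall>v\<in>S. f v = cgm_coloring I v)"
        by (intro exI[of _ col])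
          (simp add: I_def cgm_motif_cnf_to_cgm r_def m_def col_def cgm_coloring_cnf_to_cgm)
    qed
    then show ?thesis
      unfolding cgm_solvable_def connected_induce_iff[OF sym] E_def
      by (simp add: I_def cgm_verts_cnf_to_cgm r_def m_def)
  qed
  show ?thesis unfolding I_def[symmetric] solvable
  proof
    assume "\<exists>S\<subseteq>{..<2 * r + m + 1}. S \<noteq> {} \<and>
      (\<forall>u\<in>S. \<forall>v\<in>S. (u, v) \<in> rtrancl_on S (E S)) \<and> bij_betw col S {..<r + m + 1}"
    then obtain S where conn: "\<And>u v. u \<in> S \<Longrightarrow> v \<in> S \<Longrightarrow> (u, v) \<in> rtrancl_on S (E S)"
      and inj: "inj_on col S" and img: "col ` S = {..<r + m + 1}"
      by (auto simp: bij_betw_def)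
    \<comment> \<open>Color \<open>r + j\<close> occurs on one vertex only, so all clause vertices
      and the root are forced into \<open>S\<close>.\<close>
    have high: "2 * r + j \<in> S" if "j \<le> m" for j
    proof -
      have "r + j \<in> col ` S" using that unfolding img by simp
      then obtain v where "v \<in> S" "r + j = col v" by blast
      moreover from this have "v = 2 * r + j" by (auto simp: col_def split: if_splits)
      ultimately show ?thesis by simp
    qed
    have "\<exists>(x, b)\<in>set C. (x \<in> S) = b" if C: "C \<in> set \<Phi>" for C
    proof -
      obtain j where j: "j < m" "C = \<Phi> ! j" using C by (auto simp: in_set_conv_nth m_def)
      have "(2 * r + j, 2 * r + m) \<in> rtrancl_on S (E S)" using j by (intro conn high) auto
      \<comment> \<open>Clause vertex and root differ, so the path between them has a first arc, and
        a clause vertex is adjacent only to literals it contains.\<close>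
      then obtain u where "(2 * r + j, u) \<in> E S"
        using j by (cases rule: converse_rtrancl_on_cases) auto
      then have u: "u \<in> S" "u < 2 * r" "vertex_literal r u \<in> set C"
        using j by (auto simp: E_def arc edge)
      show ?thesis
      proof (cases "u < r")
        case True
        then have "(u, True) \<in> set C" using u(3) by (simp add: vertex_literal_def)
        then show ?thesis using u(1) by (intro bexI[of _ "(u, True)"]) simp_all
      next
        case False
        \<comment> \<open>Here \<open>u\<close> is a negative literal. The positive literal
          \<open>u - r\<close> has the same color, so \<open>S\<close> cannot contain both.\<close>
        have "u - r \<notin> S"
        proof
          assume "u - r \<in> S"
          then have "u - r = u"
            using inj_onD[OF inj, of "u - r" u] u False by (auto simp: col_def)
          then show False using u False by simp
        qed
        moreover have "(u - r, False) \<in> set C" using u(3) False by (simp add: vertex_literal_def)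
        ultimately show ?thesis by (intro bexI[of _ "(u - r, False)"]) simp_all
      qed
    qed
    then show "cnf_satisfiable \<Phi>"
      unfolding cnf_satisfiable_def by (intro exI[of _ "\<lambda>x. x \<in> S"]) blast
  next
    assume "cnf_satisfiable \<Phi>"
    then obtain \<alpha> where \<alpha>: "\<And>C. C \<in> set \<Phi> \<Longrightarrow> \<exists>(x, b)\<in>set C. \<alpha> x = b"
      unfolding cnf_satisfiable_def by blast
    \<comment> \<open>\<open>w\<close> picks the vertex of each color: the positive literal of a
      true variable, and otherwise \<open>r + c\<close>, which is the negative literal of a false
      variable or the only vertex with a private color.\<close>
    define w where "w = (\<lambda>c. if c < r \<and> \<alpha> c then c else r + c)"
    define S where "S = w ` {..<r + m + 1}"
    have col_w: "col (w c) = c" for c by (auto simp: col_def w_def)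
    have bij: "bij_betw col S {..<r + m + 1}"
      unfolding S_def by (rule bij_betwI[where g = w]) (auto simp: col_w)
    have S: "w c \<in> S" if "c \<le> r + m" for c using that by (auto simp: S_def)
    have sym_E: "(v, u) \<in> E S" if "(u, v) \<in> E S" for u v
      using that by (auto simp: E_def arc)
    have root: "2 * r + m \<in> S" using S[of "r + m"] by (simp add: w_def mult_2 add.assoc)
    have lit: "(w x, 2 * r + m) \<in> E S" if "x < r" for x
      using S[of x] root that by (auto simp: E_def arc edge w_def)
    \<comment> \<open>Chosen literals are adjacent to the root, and a clause reaches it through a
      chosen literal that satisfies it.\<close>
    have to_root: "(w c, 2 * r + m) \<in> (E S)\<^sup>*" if c: "c \<le> r + m" for c
    proof -
      consider "c < r" | "c = r + m" | "r \<le> c" "c < r + m"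
        using c by linarith
      then show ?thesis
      proof cases
        case 1
        then show ?thesis using lit by blast
      next
        case 2
        then show ?thesis by (simp add: w_def mult_2 add.assoc)
      next
        case 3
        define j where "j = c - r"
        have j: "j < m" "c = r + j" using 3 by (auto simp: j_def)
        then have C: "\<Phi> ! j \<in> set \<Phi>" by (simp add: m_def)
        then obtain x b where x: "(x, b) \<in> set (\<Phi> ! j)" "\<alpha> x = b" using \<alpha> by blast
        have "x < r" using vars[OF C x(1)] .
        then have "vertex_literal r (w x) = (x, b)" "w x < 2 * r"
          using x(2) by (auto simp: vertex_literal_def w_def)
        moreover have "w c = 2 * r + j" using j by (simp add: w_def mult_2 add.assoc)
        ultimately have "(w x, w c) \<in> E S"
          using S[of x] S[of c] x(1) j \<open>x < r\<close> that by (auto simp: E_def arc edge)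
        then show ?thesis using sym_E lit[OF \<open>x < r\<close>] by (meson converse_rtrancl_into_rtrancl r_into_rtrancl)
      qed
    qed
    have "(u, v) \<in> rtrancl_on S (E S)" if "u \<in> S" "v \<in> S" for u v
    proof -
      have "(u, 2 * r + m) \<in> (E S)\<^sup>*" "(v, 2 * r + m) \<in> (E S)\<^sup>*"
        using that to_root by (auto simp: S_def)
      moreover have "sym ((E S)\<^sup>*)" using sym_E by (intro sym_rtrancl symI)
      ultimately have "(u, v) \<in> (E S)\<^sup>*" by (meson rtrancl_trans symD)
      then show ?thesis
        using that by (intro rtrancl_consistent_rtrancl_on) (auto simp: E_def)
    qed
    moreover have "S \<subseteq> {..<2 * r + m + 1}" by (auto simp: S_def w_def)
    ultimately show "\<exists>S\<subseteq>{..<2 * r + m + 1}. S \<noteq> {} \<and>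
      (\<forall>u\<in>S. \<forall>v\<in>S. (u, v) \<in> rtrancl_on S (E S)) \<and> bij_betw col S {..<r + m + 1}"
      using bij root by blast
  qed
qed

section \<open>The reduction as a function on encodings\<close>

definition dlit_eq :: "data \<Rightarrow> data \<Rightarrow> data" where
  "dlit_eq l l' = dif (dnat_eq (fst_data l) (fst_data l'))
     (dif (snd_data l) (snd_data l') (dif (snd_data l') Nl dtrue)) Nl"

definition dmem :: "data \<Rightarrow> data \<Rightarrow> data" where
  "dmem l C = dex (\<lambda>l'. dlit_eq l l') C"

text \<open>Listing positive before negative literals makes the position of a literal its vertex
  number.\<close>

definition dlits :: "data \<Rightarrow> data" where
  "dlits d = dapp (dmap (\<lambda>x. Node x dtrue) (dupto (fst_data d)))
     (dmap (\<lambda>x. Node x Nl) (dupto (fst_data d)))"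

text \<open>The columns of a row form three blocks: literals, clauses, root. Entries are computed
  from the literal or clause itself, so nothing has to be looked up by its index.\<close>

definition drow :: "(data \<Rightarrow> data) \<Rightarrow> (data \<Rightarrow> data) \<Rightarrow> data \<Rightarrow> data \<Rightarrow> data" where
  "drow f g b d = dapp (dmap f (dlits d)) (dapp (dmap g (snd_data d)) (Node b Nl))"

definition dmatrix :: "data \<Rightarrow> data" where
  "dmatrix d = dapp (dmap (\<lambda>l. drow (\<lambda>_. Nl) (\<lambda>C. dmem l C) dtrue d) (dlits d))
     (dapp (dmap (\<lambda>C. drow (\<lambda>l. dmem l C) (\<lambda>_. Nl) Nl d) (snd_data d))
       (Node (drow (\<lambda>_. dtrue) (\<lambda>_. Nl) Nl d) Nl))"

text \<open>Appending to the unary \<open>r\<close> is addition, which turns 0 to \<open>m\<close>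
  into the colors of clauses and root; the extra \<open>Node Nl\<close> makes room for the
  root.\<close>

definition dcolors :: "data \<Rightarrow> data" where
  "dcolors d = dapp (dmap fst_data (dlits d))
     (dmap (\<lambda>x. dapp (fst_data d) x) (dupto (Node Nl (snd_data d))))"

text \<open>Every color lies in the motif, so only the length \<open>r + m + 1\<close> matters; it
  is obtained by concatenating the unary \<open>r\<close>, one extra entry and the clause
  list.\<close>

definition dmotif :: "data \<Rightarrow> data" where
  "dmotif d = dmap (\<lambda>_. dtrue) (dapp (fst_data d) (Node Nl (snd_data d)))"

definition dred :: "data \<Rightarrow> data" where
  "dred d = Node (dmatrix d) (Node (dcolors d) (dmotif d))"

lemmas fptime_basic = fptime_id fptime_Nl fptime_fst fptime_snd fptime_Node

lemma fptime_dmem: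
  assumes "fptime f" "fptime g"
  shows "fptime (\<lambda>d. dmem (f d) (g d))"
proof -
  have "fptime (\<lambda>e. dmem (fst_data e) (snd_data e))"
    unfolding dmem_def dlit_eq_def
    by (intro fptime_dex fptime_if fptime_dnat_eq fptime_basic)
  from fptime_comp[OF fptime_Node[OF assms] this] show ?thesis by simp
qed

lemma fptime_dlits: "fptime f \<Longrightarrow> fptime (\<lambda>d. dlits (f d))"
  unfolding dlits_def by (intro fptime_dapp fptime_dmap fptime_dupto fptime_basic)

lemma fptime_drow:
  assumes "fptime (\<lambda>e. f (fst_data e) (snd_data e))" "fptime (\<lambda>e. g (fst_data e) (snd_data e))"
    "fptime b" "fptime h"
  shows "fptime (\<lambda>d. drow (\<lambda>x. f x d) (\<lambda>x. g x d) (b d) (h d))"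
  unfolding drow_def by (intro fptime_dapp fptime_dmap fptime_dlits fptime_basic assms)

lemma fptime_dred: "fptime dred"
proof -
  have "fptime dmatrix" unfolding dmatrix_def
    by (intro fptime_dapp fptime_dmap fptime_dlits fptime_drow fptime_dmem fptime_basic)
  moreover have "fptime dcolors" unfolding dcolors_def
    by (intro fptime_dapp fptime_dmap fptime_dlits fptime_dupto fptime_basic)
  moreover have "fptime dmotif" unfolding dmotif_def
    by (intro fptime_dapp fptime_dmap fptime_basic)
  ultimately show ?thesis unfolding dred_def by (intro fptime_Node)
qed

lemma enc_bool_neq_Nl [simp]: "enc_bool b \<noteq> Nl \<longleftrightarrow> b"
  by (cases b) auto

lemma dmem_enc: "dmem (enc_literal l) (enc_list enc_literal C) = enc_bool (l \<in> set C)"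
proof -
  have "dlit_eq (enc_literal l) (enc_literal l') = enc_bool (l = l')" for l l'
    by (cases l; cases l'; cases "snd l"; cases "snd l'")
      (auto simp: dlit_eq_def enc_literal_def dnat_eq_enc_nat)
  then show ?thesis by (simp add: dmem_def dex_enc_list)
qed

lemma enc_list_upt_add:
  "enc_list f [0..<a + b] = dapp (enc_list f [0..<a]) (enc_list (\<lambda>i. f (a + i)) [0..<b])"
proof -
  have "[0..<a + b] = [0..<a] @ map (\<lambda>i. a + i) [0..<b]"
    using upt_add_eq_append[of 0 a b] map_add_upt[of a b] by (simp add: add.commute)
  then show ?thesis by (simp add: enc_list_map flip: dapp_enc_list)
qed

lemma enc_list_nth: "enc_list f xs = enc_list (\<lambda>i. f (xs ! i)) [0..<length xs]"
  using enc_list_map[of f "(!) xs" "[0..<length xs]"] by (simp add: map_nth)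

text \<open>Unary numbers are lists of \<open>Nl\<close>, so facts about list operations such as
  \<open>dupto\<close> apply to them.\<close>

lemma enc_nat_eq_enc_list: "enc_nat n = enc_list (\<lambda>_. Nl) [0..<n]"
proof (induction n)
  case (Suc n)
  then show ?case using enc_list_upt_add[of "\<lambda>_. Nl" 1 n] by simp
qed simp

lemma dlits_enc_cnf:
  "dlits (enc_cnf \<Phi>) = enc_list (\<lambda>i. enc_literal (vertex_literal (num_vars \<Phi>) i)) [0..<2 * num_vars \<Phi>]"
proof -
  have "dupto (enc_nat n) = enc_list enc_nat [0..<n]" for n
    by (simp add: enc_nat_eq_enc_list dupto_enc_list)
  then show ?thesis
    by (auto simp: dlits_def enc_cnf_def mult_2 enc_list_upt_add dmap_enc_list enc_literal_def
        vertex_literal_def intro!: arg_cong2[where f = dapp] enc_list_cong)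
qed

lemma enc_list_vertices:
  "enc_list f [0..<2 * r + m + 1] = dapp (enc_list f [0..<2 * r])
    (dapp (enc_list (\<lambda>j. f (2 * r + j)) [0..<m]) (Node (f (2 * r + m)) Nl))"
  using enc_list_upt_add[of f "2 * r" "m + 1"] enc_list_upt_add[of "\<lambda>i. f (2 * r + i)" m 1]
  by (simp add: add.assoc)

lemma dred_enc_cnf: "dred (enc_cnf \<Phi>) = enc_cgm (cnf_to_cgm \<Phi>)"
proof -
  define r m where "r = num_vars \<Phi>" and "m = length \<Phi>"
  let ?d = "enc_cnf \<Phi>" and ?C = "\<lambda>j. enc_list enc_literal (\<Phi> ! j)"
  let ?l = "\<lambda>i. enc_literal (vertex_literal r i)"
  let ?A = "\<lambda>u v. literal_edge \<Phi> u v \<or> literal_edge \<Phi> v u"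
  have lits: "dlits ?d = enc_list ?l [0..<2 * r]"
    by (simp add: dlits_enc_cnf r_def)
  have clauses: "snd_data ?d = enc_list ?C [0..<m]"
    using enc_list_nth[of "enc_list enc_literal" \<Phi>] by (simp add: enc_cnf_def m_def)
  have vars: "fst_data ?d = enc_nat r" by (simp add: enc_cnf_def r_def)
  have edge: "literal_edge \<Phi> u v \<longleftrightarrow> u < 2 * r \<and>
      (v = 2 * r + m \<or> (\<exists>j<m. v = 2 * r + j \<and> vertex_literal r u \<in> set (\<Phi> ! j)))" for u v
    by (simp add: literal_edge_def r_def m_def Let_def)
  \<comment> \<open>One statement covers the rows of literals, clauses and root: it suffices to
    check each block of columns.\<close>
  have row: "drow f g b ?d = enc_list (\<lambda>v. enc_bool (?A u v)) [0..<2 * r + m + 1]"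
    if "\<And>i. i < 2 * r \<Longrightarrow> f (?l i) = enc_bool (?A u i)"
      "\<And>j. j < m \<Longrightarrow> g (?C j) = enc_bool (?A u (2 * r + j))"
      "b = enc_bool (?A u (2 * r + m))" for f g b u
    unfolding drow_def lits clauses dmap_enc_list enc_list_vertices
    using that by (auto intro!: arg_cong2[where f = dapp] enc_list_cong)
  have matrix: "dmatrix ?d = enc_list (\<lambda>u. enc_list (\<lambda>v. enc_bool (?A u v)) [0..<2 * r + m + 1])
      [0..<2 * r + m + 1]"
    unfolding dmatrix_def lits clauses dmap_enc_list
      enc_list_vertices[of "\<lambda>u. enc_list (\<lambda>v. enc_bool (?A u v)) [0..<2 * r + m + 1]"]
    by (intro arg_cong2[where f = dapp] arg_cong2[where f = Node] enc_list_cong row refl)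
      (auto simp: dmem_enc edge intro!: arg_cong[where f = enc_bool])
  have "dupto (Node Nl (snd_data ?d)) = enc_list enc_nat [0..<m + 1]"
  proof -
    have "Node Nl (snd_data ?d) = enc_list (\<lambda>x. x) (Nl # map ?C [0..<m])"
      by (simp add: clauses enc_list_map)
    then show ?thesis using dupto_enc_list[of "\<lambda>x. x" "Nl # map ?C [0..<m]"] by simp
  qed
  then have colors: "dcolors ?d = enc_list (\<lambda>v. enc_nat (if v < r then v else v - r)) [0..<2 * r + m + 1]"
    using enc_list_upt_add[of "\<lambda>v. enc_nat (if v < r then v else v - r)" "2 * r" "m + 1"]
    by (auto simp: dcolors_def lits vars dmap_enc_list dapp_enc_nat add.assoc enc_literal_def
        vertex_literal_def simp del: upt_Suc intro!: arg_cong2[where f = dapp] enc_list_cong)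
  have motif: "dmotif ?d = enc_list (\<lambda>c. enc_bool (c \<in> {..<r + m + 1})) [0..<r + m + 1]"
  proof -
    have "dapp (fst_data ?d) (Node Nl (snd_data ?d))
        = enc_list (\<lambda>x. x) (replicate r Nl @ Nl # map ?C [0..<m])"
      by (simp add: vars clauses enc_list_map enc_nat_eq_enc_list map_replicate_const
          flip: dapp_enc_list enc_list_map[of "\<lambda>x. x" "\<lambda>_. Nl"])
    then have "dmotif ?d = enc_list (\<lambda>_. dtrue) (replicate r Nl @ Nl # map ?C [0..<m])"
      by (simp add: dmotif_def dmap_enc_list)
    also have "\<dots> = enc_list (\<lambda>_. dtrue) [0..<r + m + 1]"
      by (subst enc_list_nth) simp
    also have "\<dots> = enc_list (\<lambda>c. enc_bool (c \<in> {..<r + m + 1})) [0..<r + m + 1]"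
      by (intro enc_list_cong) (simp del: upt_Suc add: less_Suc_eq_le)
    finally show ?thesis .
  qed
  show ?thesis
    unfolding dred_def matrix colors motif unfolding r_def m_def
    by (simp add: enc_cgm_def Let_def cgm_verts_cnf_to_cgm cgm_colors_cnf_to_cgm cgm_motif_cnf_to_cgm
        cgm_coloring_cnf_to_cgm parcs_cnf_to_cgm)
qed

section \<open>Size bounds and the contradiction to SETH\<close>

lemma num_vars_le_cnf_size: "num_vars \<Phi> \<le> cnf_size \<Phi>"
proof -
  have "num_vars \<Phi> \<le> (\<Sum>C\<leftarrow>\<Phi>. length C)"
  proof (induction \<Phi>)
    case (Cons C \<Phi>)
    have "cnf_vars (C # \<Phi>) = fst ` set C \<union> cnf_vars \<Phi>" by (auto simp: cnf_vars_def)
    then have "num_vars (C # \<Phi>) \<le> card (fst ` set C) + num_vars \<Phi>"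
      by (simp add: num_vars_def card_Un_le)
    moreover have "card (fst ` set C) \<le> length C"
      by (meson card_image_le card_length finite_set order_trans)
    ultimately show ?case using Cons by simp
  qed (simp add: num_vars_def cnf_vars_def)
  also have "\<dots> \<le> cnf_size \<Phi>" unfolding cnf_size_def by (rule sum_list_mono) simp
  finally show ?thesis .
qed

lemma length_le_cnf_size: "length \<Phi> \<le> cnf_size \<Phi>"
  by (induction \<Phi>) (auto simp: cnf_size_def)

text \<open>In an instance, variable indices lie below the number of variables, so a unary index
  costs at most \<open>n = cnf_size \<Phi>\<close>. The clauses contribute
  \<open>n * (n + 3)\<close>, the variable count \<open>n\<close>, and the outer node 1.\<close>

lemma size_enc_cnf_le:
  assumes "\<Phi> \<in> cnf_instances"
  shows "size (enc_cnf \<Phi>) \<le> poly [:1, 4, 1:] (cnf_size \<Phi>)"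
proof -
  let ?n = "cnf_size \<Phi>"
  have clause: "size (enc_list enc_literal C) + 1 \<le> (length C + 1) * (?n + 3)" if C: "C \<in> set \<Phi>" for C
  proof -
    have "size (enc_literal l) + 1 \<le> ?n + 3" if l: "l \<in> set C" for l
    proof -
      have "fst l < num_vars \<Phi>"
        using assms C l by (force simp: cnf_instances_def cnf_vars_def)
      moreover have "size (enc_bool (snd l)) \<le> 1" by (cases "snd l") auto
      ultimately show ?thesis using num_vars_le_cnf_size[of \<Phi>] by (simp add: enc_literal_def)
    qed
    then have "size (enc_list enc_literal C) \<le> (\<Sum>l\<leftarrow>C. ?n + 3)"
      unfolding size_enc_list by (intro sum_list_mono) auto
    then show ?thesis by (simp add: sum_list_triv algebra_simps)
  qed
  have "size (enc_list (enc_list enc_literal) \<Phi>) \<le> (\<Sum>C\<leftarrow>\<Phi>. (length C + 1) * (?n + 3))"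
    unfolding size_enc_list[of "enc_list enc_literal"] by (rule sum_list_mono) (rule clause)
  also have "\<dots> = ?n * (?n + 3)" by (simp only: cnf_size_def sum_list_mult_const)
  finally show ?thesis using num_vars_le_cnf_size[of \<Phi>]
    by (simp add: enc_cnf_def algebra_simps)
qed

theorem theorem2:
  assumes "SETH"
  shows "\<not> (\<exists>\<epsilon>::real. \<epsilon> > 0 \<and> (\<exists>q :: nat poly.
    solvable_within cgm_instances cgm_solvable enc_cgm
      (\<lambda>I. (2 - \<epsilon>) ^ cgm_param I * real (poly q (card (cgm_verts I))))))"
proof (rule notI, elim exE conjE)
  fix \<epsilon> :: real and q :: "nat poly"
  assume \<epsilon>: "\<epsilon> > 0" and solv: "solvable_within cgm_instances cgm_solvable enc_cgm
      (\<lambda>I. (2 - \<epsilon>) ^ cgm_param I * real (poly q (card (cgm_verts I))))"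
  \<comment> \<open>A single variable makes the parameter 1. With \<epsilon> at least 2 the time
    bound would then be at most 0, but every run takes at least one step.\<close>
  have "\<epsilon> < 2"
  proof (rule ccontr)
    assume "\<not> \<epsilon> < 2"
    let ?I = "cnf_to_cgm [[(0, True)]]"
    have "num_vars [[(0, True)]] = 1" by (simp add: num_vars_def cnf_vars_def)
    then have "cgm_param ?I = 1" by (simp add: cgm_param_cnf_to_cgm)
    moreover have "?I \<in> cgm_instances" by (rule cnf_to_cgm_instance)
    ultimately obtain p t s where t: "exec p (init_store (enc_cgm ?I)) t s"
      "real t \<le> (2 - \<epsilon>) * real (poly q (card (cgm_verts ?I)))"
      using solv unfolding solvable_within_def by (metis power_one_right)
    have "0 < t" using t(1) by (induction rule: exec.induct) auto
    moreover have "(2 - \<epsilon>) * real (poly q (card (cgm_verts ?I))) \<le> 0"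
      using \<open>\<not> \<epsilon> < 2\<close> by (intro mult_nonpos_nonneg) auto
    ultimately show False using t(2) by linarith
  qed
  \<comment> \<open>The cap at 1 keeps \<open>2 - \<delta>\<close> at least 1, so that its power
    absorbs the additive polynomial cost of the reduction.\<close>
  define \<delta> where "\<delta> = min \<epsilon> 1"
  have "\<exists>q1 :: nat poly. solvable_within cnf_instances cnf_satisfiable enc_cnf
      (\<lambda>\<Phi>. real (poly q1 (size (enc_cnf \<Phi>)))
        + (2 - \<epsilon>) ^ cgm_param (cnf_to_cgm \<Phi>) * real (poly q (card (cgm_verts (cnf_to_cgm \<Phi>)))))"
    by (rule solvable_within_reduction[where red = cnf_to_cgm, OF fptime_dred _ _ _ solv])
      (simp_all add: cnf_to_cgm_instance dred_enc_cnf cgm_solvable_cnf_to_cgm)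
  then obtain q1 :: "nat poly" where q1: "solvable_within cnf_instances cnf_satisfiable enc_cnf
      (\<lambda>\<Phi>. real (poly q1 (size (enc_cnf \<Phi>)))
        + (2 - \<epsilon>) ^ cgm_param (cnf_to_cgm \<Phi>) * real (poly q (card (cgm_verts (cnf_to_cgm \<Phi>)))))"
    by blast
  \<comment> \<open>\<open>[:1, 4, 1:]\<close> bounds the size of the encoded formula, and
    \<open>[:1, 3:]\<close> the number \<open>2 r + m + 1\<close> of vertices, as \<open>r\<close>
    and \<open>m\<close> are at most the formula size.\<close>
  define q' where "q' = pcompose q1 [:1, 4, 1:] + pcompose q [:1, 3:]"
  have bound: "real (poly q1 (size (enc_cnf \<Phi>)))
        + (2 - \<epsilon>) ^ cgm_param (cnf_to_cgm \<Phi>) * real (poly q (card (cgm_verts (cnf_to_cgm \<Phi>))))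
      \<le> (2 - \<delta>) ^ num_vars \<Phi> * real (poly q' (cnf_size \<Phi>))" if \<Phi>: "\<Phi> \<in> cnf_instances" for \<Phi>
  proof -
    have "poly q1 (size (enc_cnf \<Phi>)) \<le> poly q1 (poly [:1, 4, 1:] (cnf_size \<Phi>))"
      using size_enc_cnf_le[OF \<Phi>] by (rule poly_nat_mono)
    moreover have "1 \<le> (2 - \<delta>) ^ num_vars \<Phi>" by (rule one_le_power) (simp add: \<delta>_def)
    ultimately have 1: "real (poly q1 (size (enc_cnf \<Phi>)))
        \<le> (2 - \<delta>) ^ num_vars \<Phi> * real (poly q1 (poly [:1, 4, 1:] (cnf_size \<Phi>)))"
      using mult_mono[of 1 "(2 - \<delta>) ^ num_vars \<Phi>" "real (poly q1 (size (enc_cnf \<Phi>)))"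
          "real (poly q1 (poly [:1, 4, 1:] (cnf_size \<Phi>)))"] by simp
    have "card (cgm_verts (cnf_to_cgm \<Phi>)) \<le> poly [:1, 3:] (cnf_size \<Phi>)"
      using num_vars_le_cnf_size[of \<Phi>] length_le_cnf_size[of \<Phi>] by (simp add: cgm_verts_cnf_to_cgm)
    then have "poly q (card (cgm_verts (cnf_to_cgm \<Phi>))) \<le> poly q (poly [:1, 3:] (cnf_size \<Phi>))"
      by (rule poly_nat_mono)
    moreover have "(2 - \<epsilon>) ^ num_vars \<Phi> \<le> (2 - \<delta>) ^ num_vars \<Phi>"
      using \<open>\<epsilon> < 2\<close> by (intro power_mono) (auto simp: \<delta>_def)
    ultimately have "(2 - \<epsilon>) ^ num_vars \<Phi> * real (poly q (card (cgm_verts (cnf_to_cgm \<Phi>))))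
        \<le> (2 - \<delta>) ^ num_vars \<Phi> * real (poly q (poly [:1, 3:] (cnf_size \<Phi>)))"
      using \<open>\<epsilon> < 2\<close> by (intro mult_mono) (auto simp: \<delta>_def)
    with 1 show ?thesis
      unfolding q'_def poly_add poly_pcompose of_nat_add distrib_left cgm_param_cnf_to_cgm
      by (rule add_mono)
  qed
  have "solvable_within cnf_instances cnf_satisfiable enc_cnf
      (\<lambda>\<Phi>. (2 - \<delta>) ^ num_vars \<Phi> * real (poly q' (cnf_size \<Phi>)))"
    using q1 bound by (rule solvable_within_mono)
  moreover have "\<delta> > 0" using \<epsilon> by (simp add: \<delta>_def)
  ultimately show False using assms unfolding SETH_def by blast
qed

end
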